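(* Let $X,Y$ be $n\times n$ Hermitian positive definite matrices. Then the function $$g(A):=\delta_S^2(A+X,A+Y),$$ defined for $n\times n$ Hermitian positive semidefinite matrices $A\ge 0$, is monotonically decreasing and convex in $A$.
   Context: For Hermitian positive definite $X,Y$: $\delta_S^2(X,Y):=\log\det\left(\frac{X+Y}{2}\right)-\frac12\log\det(XY)$. Monotonically decreasing is with respect to the L&ouml;wner order: $A\le B$ (i.e. $B-A$ positive semidefinite) implies $g(A)\ge g(B)$. *)

theory Defs
  imports "HOL-Analysis.Analysis"
begin

definition hermitian :: "complex^'n^'n \<Rightarrow> bool" where
  "hermitian A \<longleftrightarrow> (\<forall>i j. A $ i $ j = cnj (A $ j $ i))"

definition quad_form :: "complex^'n^'n \<Rightarrow> complex^'n \<Rightarrow> complex" where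
  "quad_form A v = (\<Sum>i\<in>UNIV. cnj (v $ i) * (A *v v) $ i)"

(* For Hermitian A the quadratic form is real-valued, so taking the real part discards nothing. *)
definition pos_def :: "complex^'n^'n \<Rightarrow> bool" where
  "pos_def A \<longleftrightarrow> hermitian A \<and> (\<forall>v. v \<noteq> 0 \<longrightarrow> Re (quad_form A v) > 0)"

definition pos_semidef :: "complex^'n^'n \<Rightarrow> bool" where
  "pos_semidef A \<longleftrightarrow> hermitian A \<and> (\<forall>v. Re (quad_form A v) \<ge> 0)"

definition loewner_le :: "complex^'n^'n \<Rightarrow> complex^'n^'n \<Rightarrow> bool" where
  "loewner_le A B \<longleftrightarrow> pos_semidef (B - A)"

(* The square of the S-divergence distance. It is only meaningful for positive definite arguments:
   there (X + Y) / 2 is positive definite and det (X ** Y) = det X * det Y, so both determinants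
   are positive reals and Re merely changes the type from complex to real. *)
definition S_div_sq :: "complex^'n^'n \<Rightarrow> complex^'n^'n \<Rightarrow> real" where
  "S_div_sq X Y = ln (Re (det ((1/2) *\<^sub>R (X + Y)))) - 1/2 * ln (Re (det (X ** Y)))"

end

theory Submission
  imports Defs
begin

text \<open>
  Along a line \<open>A + t H\<close> the derivative of \<open>ln det\<close> is \<open>t \<mapsto> tr (H (A + t H)\<^sup>-\<^sup>1)\<close>, so with
  \<open>P = A + X\<close>, \<open>Q = A + Y\<close>, \<open>M = (P + Q) / 2\<close> the divergence has slope
  \<open>tr (H (M\<^sup>-\<^sup>1 - P\<^sup>-\<^sup>1 / 2 - Q\<^sup>-\<^sup>1 / 2))\<close>. Operator convexity of the inverse makes it nonpositive
  for \<open>H \<ge> 0\<close>. By the resolvent identity the slope is nondecreasing in \<open>t\<close> as soon as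
  \<open>(P, P') \<mapsto> tr (H P\<^sup>-\<^sup>1 H P'\<^sup>-\<^sup>1)\<close> is midpoint convex on pairs displaced by the same Hermitian
  \<open>K = (Q - P) / 2\<close>; this follows from an algebraic identity whose terms are traces of products of
  positive semidefinite matrices, so neither square roots nor diagonalisation are needed.
\<close>

section \<open>Adjoints and positivity\<close>

definition adj :: "complex^'n^'n \<Rightarrow> complex^'n^'n" where
  "adj A = (\<chi> i j. cnj (A $ j $ i))"

definition cdot :: "complex^'n \<Rightarrow> complex^'n \<Rightarrow> complex" where
  "cdot u v = (\<Sum>i\<in>UNIV. cnj (u $ i) * v $ i)"

lemma hermitian_iff_adj: "hermitian A \<longleftrightarrow> adj A = A"
  unfolding hermitian_def adj_def vec_eq_iff by (simp add: eq_commute)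

lemma quad_form_eq_cdot: "quad_form A v = cdot v (A *v v)"
  by (simp add: quad_form_def cdot_def)

lemma adj_adj [simp]: "adj (adj A) = A"
  by (simp add: adj_def vec_eq_iff)

lemma adj_mult: "adj (A ** B) = adj B ** adj A"
  by (simp add: adj_def matrix_matrix_mult_def vec_eq_iff mult.commute)

lemma adj_add: "adj (A + B) = adj A + adj B"
  by (simp add: adj_def vec_eq_iff)

lemma adj_diff: "adj (A - B) = adj A - adj B"
  by (simp add: adj_def vec_eq_iff)

lemma adj_scaleR: "adj (r *\<^sub>R A) = r *\<^sub>R adj A"
  by (simp add: adj_def vec_eq_iff)

lemma adj_mat_1 [simp]: "adj (mat 1) = mat 1"
  by (simp add: adj_def mat_def vec_eq_iff)

lemma det_adj: "det (adj A) = cnj (det A)"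
proof -
  have "det (adj A) = det (transpose (adj A))"
    by simp
  also have "\<dots> = cnj (det A)"
    by (simp add: det_def adj_def transpose_def)
  finally show ?thesis .
qed

lemma Re_cnj_mult_self: "Re (cnj z * z) = (cmod z)\<^sup>2"
  by (subst cmod_power2) (simp add: power2_eq_square)

section \<open>The sesquilinear pairing and adjoints\<close>

lemma cdot_add_right: "cdot w (u + v) = cdot w u + cdot w v"
  and cdot_diff_left: "cdot (u - v) w = cdot u w - cdot v w"
  and cdot_diff_right: "cdot w (u - v) = cdot w u - cdot w v"
  and cdot_scale_left: "cdot (a *s u) w = cnj a * cdot u w"
  and cdot_scale_right: "cdot w (a *s u) = a * cdot w u"
  and cnj_cdot: "cnj (cdot u w) = cdot w u"
  by (simp_all add: cdot_def algebra_simps sum.distrib sum_subtractf sum_distrib_left)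

lemma cdot_adj: "cdot u (A *v v) = cdot (adj A *v u) v"
proof -
  have "cdot u (A *v v) = (\<Sum>i\<in>UNIV. \<Sum>j\<in>UNIV. cnj (u $ i) * (A $ i $ j * v $ j))"
    by (simp add: cdot_def matrix_vector_mult_def sum_distrib_left)
  also have "\<dots> = (\<Sum>j\<in>UNIV. \<Sum>i\<in>UNIV. cnj (u $ i) * (A $ i $ j * v $ j))"
    by (rule sum.swap)
  also have "\<dots> = cdot (adj A *v u) v"
    by (simp add: cdot_def matrix_vector_mult_def adj_def sum_distrib_left sum_distrib_right mult_ac)
  finally show ?thesis .
qed

lemma cdot_axis_left [simp]: "cdot (axis k 1) v = v $ k"
proof -
  have "cdot (axis k 1) v = (\<Sum>i\<in>UNIV. if i = k then v $ i else 0)"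
    unfolding cdot_def by (rule sum.cong) (auto simp: axis_def)
  then show ?thesis by simp
qed

section \<open>Sums, multiples, congruences and inverses of positive matrices\<close>

lemma quad_form_add: "quad_form (A + B) v = quad_form A v + quad_form B v"
  by (simp add: quad_form_eq_cdot matrix_vector_mult_add_rdistrib cdot_add_right)

lemma quad_form_scaleR: "quad_form (r *\<^sub>R A) v = r *\<^sub>R quad_form A v"
  by (simp add: quad_form_def matrix_vector_mult_def flip: scaleR_sum_right)

lemma quad_form_congruence: "quad_form (Z ** A ** adj Z) v = quad_form A (adj Z *v v)"
  by (simp add: quad_form_eq_cdot cdot_adj[of v Z] flip: matrix_vector_mul_assoc)

lemma quad_form_kernel: "A *v v = 0 \<Longrightarrow> Re (quad_form A v) = 0"
  by (simp add: quad_form_def)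

lemma pos_def_imp_pos_semidef: "pos_def A \<Longrightarrow> pos_semidef A"
  unfolding pos_def_def pos_semidef_def
  by (metis matrix_vector_mult_0_right quad_form_kernel less_eq_real_def)

lemma pos_semidef_add: "pos_semidef A \<Longrightarrow> pos_semidef B \<Longrightarrow> pos_semidef (A + B)"
  by (auto simp: pos_semidef_def hermitian_iff_adj adj_add quad_form_add)

lemma pos_semidef_scaleR: "pos_semidef A \<Longrightarrow> 0 \<le> r \<Longrightarrow> pos_semidef (r *\<^sub>R A)"
  by (auto simp: pos_semidef_def hermitian_iff_adj adj_scaleR quad_form_scaleR)

lemma pos_def_add: "pos_semidef A \<Longrightarrow> pos_def B \<Longrightarrow> pos_def (A + B)"
  by (auto simp: pos_semidef_def pos_def_def hermitian_iff_adj adj_add quad_form_add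
      intro: add_nonneg_pos)

lemma pos_def_scaleR: "pos_def A \<Longrightarrow> 0 < r \<Longrightarrow> pos_def (r *\<^sub>R A)"
  by (auto simp: pos_def_def hermitian_iff_adj adj_scaleR quad_form_scaleR)

lemma pos_def_mat_1: "pos_def (mat 1 :: complex^'n^'n)"
proof -
  have "0 < Re (quad_form (mat 1) v)" if nz: "v \<noteq> 0" for v :: "complex^'n"
  proof -
    obtain k where k: "v $ k \<noteq> 0"
      using nz by (metis vec_eq_iff zero_index)
    have "Re (quad_form (mat 1) v) = (\<Sum>i\<in>UNIV. (cmod (v $ i))\<^sup>2)"
      by (simp only: quad_form_def matrix_vector_mul_lid Re_sum Re_cnj_mult_self)
    also have "\<dots> > 0"
      by (rule sum_pos2[of _ k]) (use k in auto)
    finally show ?thesis .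
  qed
  then show ?thesis
    by (simp add: pos_def_def hermitian_iff_adj)
qed

lemma pos_semidef_congruence: "pos_semidef A \<Longrightarrow> pos_semidef (Z ** A ** adj Z)"
  by (auto simp: pos_semidef_def hermitian_iff_adj adj_mult quad_form_congruence matrix_mul_assoc)

text \<open>Definiteness makes the kernel trivial, so a left inverse exists, and for square matrices
  it is two-sided. The inverse is semidefinite because it equals the congruence
  \<open>matrix_inv A ** A ** adj (matrix_inv A)\<close>.\<close>

lemma pos_def_matrix_inv:
  assumes "pos_def A"
  shows "A ** matrix_inv A = mat 1" and "matrix_inv A ** A = mat 1"
    and "pos_semidef (matrix_inv A)"
proof -
  have "x = 0" if "A *v x = 0" for x
    using assms that unfolding pos_def_def by (metis quad_form_kernel less_irrefl)
  then obtain B where "B ** A = mat 1"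
    using matrix_left_invertible_ker[of A] by blast
  then have "\<exists>B. A ** B = mat 1 \<and> B ** A = mat 1"
    by (metis matrix_left_right_inverse)
  then have inv: "A ** matrix_inv A = mat 1 \<and> matrix_inv A ** A = mat 1"
    unfolding matrix_inv_def by (rule someI_ex)
  then show "A ** matrix_inv A = mat 1" and "matrix_inv A ** A = mat 1"
    by blast+
  have "A ** adj (matrix_inv A) = adj (matrix_inv A ** A)"
    using assms by (simp add: adj_mult pos_def_def hermitian_iff_adj)
  then have "matrix_inv A ** A ** adj (matrix_inv A) = matrix_inv A"
    by (metis inv adj_mat_1 matrix_mul_assoc matrix_mul_rid)
  then show "pos_semidef (matrix_inv A)"
    using pos_semidef_congruence[OF pos_def_imp_pos_semidef[OF assms], of "matrix_inv A"] by simp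
qed

section \<open>Determinants of positive definite matrices\<close>

lemma det_pos_def_neq_0: "pos_def A \<Longrightarrow> det A \<noteq> 0"
  using pos_def_matrix_inv(1,2) by (metis invertible_def invertible_det_nz)

lemma Im_det_pos_def: "pos_def A \<Longrightarrow> Im (det A) = 0"
  using det_adj[of A] by (simp add: pos_def_def hermitian_iff_adj complex_eq_iff)

text \<open>The determinant has no zero on the segment from the identity to \<open>A\<close>.\<close>
lemma Re_det_pos_def:
  fixes A :: "complex^'n^'n"
  assumes "pos_def A"
  shows "0 < Re (det A)"
proof (rule ccontr)
  define f where "f t = Re (det ((1 - t) *\<^sub>R mat 1 + t *\<^sub>R A))" for t :: real
  assume "\<not> 0 < Re (det A)"
  then have "f 1 \<le> 0" "0 \<le> f 0"
    by (simp_all add: f_def)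
  moreover have "continuous_on {0..1} f"
    unfolding f_def det_def by (intro continuous_intros)
  ultimately obtain t where t: "0 \<le> t" "t \<le> 1" "f t = 0"
    using IVT2'[of f 1 0 0] by auto
  have "pos_def ((1 - t) *\<^sub>R mat 1 + t *\<^sub>R A)"
  \<comment> \<open>\<open>t *\<^sub>R A\<close> serves as the definite summand, which requires
    \<open>t\<close> to be nonzero; at \<open>t = 0\<close> the identity itself is definite.\<close>
  proof (cases "t = 0")
    case False
    then show ?thesis
      using t assms pos_def_mat_1
      by (intro pos_def_add pos_semidef_scaleR pos_def_scaleR pos_def_imp_pos_semidef) auto
  qed (simp add: pos_def_mat_1)
  \<comment> \<open>\<open>f\<close> sees only the real part, but a definite matrix has a real
    determinant, so \<open>f t = 0\<close> makes the determinant itself vanish.\<close>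
  then show False
    using det_pos_def_neq_0 Im_det_pos_def t(3) by (auto simp: f_def complex_eq_iff)
qed

section \<open>The trace of a product of positive semidefinite matrices\<close>

lemma matrix_vector_mult_axis: "(A *v axis k 1) $ i = (A :: complex^'n^'m) $ i $ k"
proof -
  have "(A *v axis k 1) $ i = (\<Sum>j\<in>UNIV. if j = k then A $ i $ j else 0)"
    unfolding matrix_vector_mult_def vec_lambda_beta by (rule sum.cong) (auto simp: axis_def)
  then show ?thesis by simp
qed

lemma pos_semidef_diag:
  assumes "pos_semidef A"
  shows "A $ k $ k = of_real (Re (A $ k $ k))" and "0 \<le> Re (A $ k $ k)"
proof -
  have "A $ k $ k = cnj (A $ k $ k)"
    using assms unfolding pos_semidef_def hermitian_def by blast
  then show "A $ k $ k = of_real (Re (A $ k $ k))"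
    by (simp add: complex_eq_iff)
  have "quad_form A (axis k 1) = A $ k $ k"
    by (simp add: quad_form_eq_cdot matrix_vector_mult_axis)
  then show "0 \<le> Re (A $ k $ k)"
    using assms by (metis pos_semidef_def)
qed

text \<open>This expands the nonnegative form at \<open>v - z *s axis k 1\<close>. One choice of
  \<open>z\<close> makes the row of a zero pivot vanish, another completes the square at a nonzero
  pivot.\<close>

lemma pos_semidef_shift:
  assumes "pos_semidef A"
  shows "0 \<le> Re (quad_form A v) - 2 * Re (cnj z * (A *v v) $ k) + (cmod z)\<^sup>2 * Re (A $ k $ k)"
proof -
  let ?e = "axis k 1 :: complex^'a"
  have adjA: "adj A = A"
    using assms by (simp add: pos_semidef_def hermitian_iff_adj)
  have 1: "cdot v (A *v ?e) = cnj ((A *v v) $ k)"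
    by (metis adjA cdot_adj cnj_cdot cdot_axis_left)
  have 2: "(A *v ?e) $ k = A $ k $ k"
    by (simp add: matrix_vector_mult_axis)
  have "quad_form A (v - z *s ?e)
      = quad_form A v - (z * cnj ((A *v v) $ k) + cnj z * (A *v v) $ k) + cnj z * z * A $ k $ k"
    by (simp add: quad_form_eq_cdot matrix_vector_mult_diff_distrib vector_scalar_commute
        cdot_diff_left cdot_diff_right cdot_scale_left cdot_scale_right 1 2 algebra_simps)
  moreover have "cnj z * z * A $ k $ k = of_real ((cmod z)\<^sup>2 * Re (A $ k $ k))"
    using pos_semidef_diag(1)[OF assms, of k] complex_norm_square[of z]
    by (metis mult.commute of_real_mult)
  moreover have "Re (z * cnj w + cnj z * w) = 2 * Re (cnj z * w)" for w
    by simp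
  ultimately have "Re (quad_form A (v - z *s ?e))
      = Re (quad_form A v) - 2 * Re (cnj z * (A *v v) $ k) + (cmod z)\<^sup>2 * Re (A $ k $ k)"
    by simp
  then show ?thesis
    using assms by (metis pos_semidef_def)
qed

text \<open>With a zero diagonal entry the quadratic term of the shifted form drops out; the
  remaining affine function of \<open>t\<close> is bounded below only if its slope is zero.\<close>

lemma pos_semidef_zero_row:
  assumes "pos_semidef A" and "A $ k $ k = 0"
  shows "A $ k $ j = 0"
proof (rule ccontr)
  define w where "w = (A *v axis j 1) $ k"
  have w: "w = A $ k $ j"
    by (simp add: w_def matrix_vector_mult_axis)
  assume "A $ k $ j \<noteq> 0"
  then have pos: "0 < (cmod w)\<^sup>2"
    by (simp add: w)
  \<comment> \<open>This \<open>t\<close> is chosen so that the affine expression takes the value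
    -1.\<close>
  define t where "t = (Re (quad_form A (axis j 1)) + 1) / (2 * (cmod w)\<^sup>2)"
  have "0 \<le> Re (quad_form A (axis j 1)) - 2 * Re (cnj (of_real t * w) * w)"
    using pos_semidef_shift[OF assms(1), of "axis j 1" "of_real t * w" k] assms(2)
    by (simp add: w_def)
  also have "Re (cnj (of_real t * w) * w) = t * (cmod w)\<^sup>2"
    unfolding Re_cnj_mult_self[symmetric] by (simp add: algebra_simps)
  also have "Re (quad_form A (axis j 1)) - 2 * (t * (cmod w)\<^sup>2) = -1"
    using pos by (simp add: t_def field_simps)
  finally show False by simp
qed

text \<open>The Schur complement of the pivot \<open>A $ k $ k\<close>, kept at full size: for a
  nonzero pivot, row and column \<open>k\<close> become zero and the matrix type does not
  change.\<close>

definition schur_reduce :: "'n \<Rightarrow> complex^'n^'n \<Rightarrow> complex^'n^'n" where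
  "schur_reduce k A = (\<chi> i j. A $ i $ j - A $ i $ k * A $ k $ j / A $ k $ k)"

text \<open>The reduced form at \<open>v\<close> is the minimum over \<open>z\<close> of the form of
  \<open>A\<close> at \<open>v - z *s axis k 1\<close>, attained at
  \<open>z = (A *v v) $ k / A $ k $ k\<close>.\<close>

lemma pos_semidef_schur_reduce:
  assumes "pos_semidef A" and "A $ k $ k \<noteq> 0"
  shows "pos_semidef (schur_reduce k A)"
proof -
  define a where "a = Re (A $ k $ k)"
  have a: "A $ k $ k = of_real a" "0 < a"
    using pos_semidef_diag[OF assms(1), of k] assms(2) by (auto simp: a_def less_le)
  have herm: "A $ i $ j = cnj (A $ j $ i)" for i j
    using assms(1) unfolding pos_semidef_def hermitian_def by blast
  have "hermitian (schur_reduce k A)"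
  proof (unfold hermitian_def, intro allI)
    fix i j
    show "schur_reduce k A $ i $ j = cnj (schur_reduce k A $ j $ i)"
      using herm[of i j] herm[of i k] herm[of k j] by (simp add: schur_reduce_def a)
  qed
  moreover have "0 \<le> Re (quad_form (schur_reduce k A) v)" for v
  proof -
    define w where "w = (A *v v) $ k"
    have w: "w = (\<Sum>j\<in>UNIV. A $ k $ j * v $ j)"
      by (simp add: w_def matrix_vector_mult_def)
    have cw: "cnj w = (\<Sum>i\<in>UNIV. cnj (v $ i) * A $ i $ k)"
      unfolding w cnj_sum by (rule sum.cong) (auto simp: mult.commute herm[symmetric])
    have "(schur_reduce k A *v v) $ i = (A *v v) $ i - A $ i $ k * w / of_real a" for i
    proof -
      have "(schur_reduce k A *v v) $ i
          = (\<Sum>j\<in>UNIV. A $ i $ j * v $ j - A $ i $ k / of_real a * (A $ k $ j * v $ j))"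
        by (simp add: schur_reduce_def matrix_vector_mult_def a algebra_simps)
      then show ?thesis
        by (simp add: sum_subtractf matrix_vector_mult_def w sum_distrib_left sum_divide_distrib)
    qed
    then have "quad_form (schur_reduce k A) v
        = (\<Sum>i\<in>UNIV. cnj (v $ i) * (A *v v) $ i - cnj (v $ i) * A $ i $ k * (w / of_real a))"
      by (simp add: quad_form_def right_diff_distrib mult.assoc)
    then have "quad_form (schur_reduce k A) v = quad_form A v - cnj w * w / of_real a"
      by (simp add: quad_form_def sum_subtractf cw sum_distrib_right sum_divide_distrib)
    then have "Re (quad_form (schur_reduce k A) v) = Re (quad_form A v) - (cmod w)\<^sup>2 / a"
      unfolding Re_cnj_mult_self[symmetric] by simp
    moreover have "Re (cnj (w / of_real a) * w) = (cmod w)\<^sup>2 / a"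
    proof -
      have "cnj (w / of_real a) * w = (cnj w * w) / of_real a"
        by simp
      then have "Re (cnj (w / of_real a) * w) = Re (cnj w * w) / a"
        by (simp only: Re_divide_of_real)
      then show ?thesis
        by (simp only: Re_cnj_mult_self)
    qed
    moreover have "(cmod (w / of_real a))\<^sup>2 * a = (cmod w)\<^sup>2 / a"
      using a(2) by (simp add: norm_divide power2_eq_square)
    ultimately show ?thesis
      using pos_semidef_shift[OF assms(1), of v "w / of_real a" k]
      unfolding a(1) w_def[symmetric] Re_complex_of_real by linarith
  qed
  ultimately show ?thesis
    by (simp add: pos_semidef_def)
qed

lemma trace_schur_reduce:
  "trace (schur_reduce k A ** B)
     = trace (A ** B) - (\<Sum>i\<in>UNIV. \<Sum>j\<in>UNIV. A $ i $ k * A $ k $ j * B $ j $ i) / A $ k $ k"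
  by (simp add: trace_def schur_reduce_def matrix_matrix_mult_def algebra_simps sum_subtractf
      sum_divide_distrib)

text \<open>Induction over the rows that may be nonzero. A zero pivot already kills its row;
  otherwise elimination clears it, and the removed rank-one part contributes a value of the
  quadratic form of \<open>B\<close> divided by the positive pivot.\<close>

lemma trace_pos_semidef_mult_supported:
  assumes "finite S" and "pos_semidef B"
  shows "pos_semidef A \<Longrightarrow> (\<And>i j. i \<notin> S \<Longrightarrow> A $ i $ j = 0) \<Longrightarrow> 0 \<le> Re (trace (A ** B))"
  using assms(1)
proof (induction S arbitrary: A rule: finite_induct)
  case empty
  then show ?case
    by (simp add: trace_def matrix_matrix_mult_def)
next
  case (insert k S)
  show ?case
  proof (cases "A $ k $ k = 0")
    case True
    then show ?thesis
      using insert.IH insert.prems pos_semidef_zero_row by (metis insertE)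
  next
    case False
    define a where "a = Re (A $ k $ k)"
    have a: "A $ k $ k = of_real a" "0 < a"
      using pos_semidef_diag[OF insert.prems(1), of k] False by (auto simp: a_def less_le)
    have herm: "A $ i $ j = cnj (A $ j $ i)" for i j
      using insert.prems(1) unfolding pos_semidef_def hermitian_def by blast
    \<comment> \<open>Elimination clears row \<open>k\<close>; any other row outside
      \<open>S\<close> was zero and stays so, because its factor \<open>A $ i $ k\<close> is
      zero.\<close>
    have "schur_reduce k A $ i $ j = 0" if "i \<notin> S" for i j
      using that insert.prems(2) False by (cases "i = k") (auto simp: schur_reduce_def)
    then have "0 \<le> Re (trace (schur_reduce k A ** B))"
      using insert.IH pos_semidef_schur_reduce[OF insert.prems(1) False] by blast
    moreover have "(\<Sum>i\<in>UNIV. \<Sum>j\<in>UNIV. A $ i $ k * A $ k $ j * B $ j $ i)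
        = quad_form B (column k A)"
    proof -
      have "(\<Sum>i\<in>UNIV. \<Sum>j\<in>UNIV. A $ i $ k * A $ k $ j * B $ j $ i)
          = (\<Sum>j\<in>UNIV. \<Sum>i\<in>UNIV. A $ i $ k * A $ k $ j * B $ j $ i)"
        by (rule sum.swap)
      also have "\<dots> = (\<Sum>j\<in>UNIV. \<Sum>i\<in>UNIV. cnj (A $ j $ k) * (B $ j $ i * A $ i $ k))"
        by (intro sum.cong refl) (simp add: mult_ac flip: herm)
      finally show ?thesis
        by (simp add: quad_form_def column_def matrix_vector_mult_def sum_distrib_left)
    qed
    moreover have "0 \<le> Re (quad_form B (column k A)) / a"
      using assms(2) a(2) by (simp add: pos_semidef_def)
    ultimately show ?thesis
      by (simp add: trace_schur_reduce a)
  qed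
qed

lemma trace_pos_semidef_mult:
  "pos_semidef A \<Longrightarrow> pos_semidef B \<Longrightarrow> 0 \<le> Re (trace (A ** B))"
  using trace_pos_semidef_mult_supported[of UNIV B A] by simp

section \<open>The derivative of the logarithm of the determinant\<close>

text \<open>In the Leibniz formula only the identity permutation contributes to first order.\<close>
lemma det_one_plus_derivative:
  fixes Z :: "complex^'n^'n"
  shows "((\<lambda>z. det (\<chi> i j. mat 1 $ i $ j + z * Z $ i $ j)) has_field_derivative trace Z) (at 0)"
proof -
  let ?I = "mat 1 :: complex^'n^'n"
  \<comment> \<open>The product rule at \<open>z = 0\<close>; the term
    \<open>0 * Z $ j $ p j\<close> keeps the shape in which the rule delivers the remaining
    factors.\<close>
  define d where "d p = (\<Sum>i\<in>UNIV. Z $ i $ p i * (\<Prod>j\<in>UNIV-{i}. ?I $ j $ p j + 0 * Z $ j $ p j))"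
    for p :: "'n \<Rightarrow> 'n"
  have "((\<lambda>z. of_int (sign p) * (\<Prod>i\<in>UNIV. ?I $ i $ p i + z * Z $ i $ p i))
      has_field_derivative of_int (sign p) * d p) (at 0)" for p
    unfolding d_def
    by (intro DERIV_cmult has_field_derivative_prod) (auto intro!: derivative_eq_intros)
  then have "((\<lambda>z. det (\<chi> i j. ?I $ i $ j + z * Z $ i $ j)) has_field_derivative
      (\<Sum>p | p permutes UNIV. of_int (sign p) * d p)) (at 0)"
    unfolding det_def by (intro DERIV_sum) simp
  moreover have "(\<Sum>p | p permutes (UNIV :: 'n set). of_int (sign p) * d p)
      = (\<Sum>p\<in>{id}. of_int (sign p) * d p)"
  proof (rule sum.mono_neutral_right)
    show "\<forall>p\<in>{p. p permutes UNIV} - {id}. of_int (sign p) * d p = 0"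
    proof
      fix p :: "'n \<Rightarrow> 'n" assume p: "p \<in> {p. p permutes UNIV} - {id}"
      \<comment> \<open>A permutation fixing every point but \<open>i\<close> also fixes
        \<open>i\<close>. So whichever factor is differentiated, a non-identity \<open>p\<close>
        leaves an off-diagonal entry of the identity in the product.\<close>
      have "\<exists>j. j \<noteq> i \<and> p j \<noteq> j" for i
      proof (rule ccontr)
        assume "\<nexists>j. j \<noteq> i \<and> p j \<noteq> j"
        then have *: "j \<noteq> i \<Longrightarrow> p j = j" for j by blast
        have "inj p"
          using p permutes_inj by blast
        then have "p i = i"
          using * by (metis injD)
        with * have "p = id" by (metis eq_id_iff)
        with p show False by simp
      qed
      then have "\<exists>j\<in>UNIV-{i}. ?I $ j $ p j + 0 * Z $ j $ p j = 0" for i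
      proof -
        obtain j where "j \<noteq> i" "p j \<noteq> j"
          using \<open>\<And>i. \<exists>j. j \<noteq> i \<and> p j \<noteq> j\<close> by blast
        then show ?thesis
          by (intro bexI[of _ j]) (auto simp: mat_def)
      qed
      then have "(\<Prod>j\<in>UNIV-{i}. ?I $ j $ p j + 0 * Z $ j $ p j) = 0" for i
        by (intro prod_zero) auto
      then show "of_int (sign p) * d p = 0"
        unfolding d_def by (simp only: mult_zero_right sum.neutral_const)
    qed
  qed (auto simp: permutes_id)
  moreover have "d id = trace Z"
    by (simp add: d_def trace_def mat_def)
  ultimately show ?thesis by simp
qed

text \<open>With \<open>W\<close> the point at \<open>t\<close>, the line factors as
  \<open>W ** (mat 1 + (s - t) *\<^sub>R (B ** H))\<close>, which reduces the claim to the
  derivative of the determinant at the identity, composed with a real path into the complex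
  plane.\<close>

lemma ln_det_line_derivative:
  fixes P H B :: "complex^'n^'n"
  assumes B: "(P + t *\<^sub>R H) ** B = mat 1" and "pos_def (P + t *\<^sub>R H)"
  shows "((\<lambda>s. ln (Re (det (P + s *\<^sub>R H)))) has_real_derivative Re (trace (H ** B))) (at t)"
proof -
  define W where "W = P + t *\<^sub>R H"
  define D where "D z = det (\<chi> i j. mat 1 $ i $ j + z * (B ** H) $ i $ j)" for z :: complex
  have line: "P + s *\<^sub>R H = W ** (\<chi> i j. mat 1 $ i $ j + of_real (s - t) * (B ** H) $ i $ j)" for s
  proof -
    have "(\<chi> i j. mat 1 $ i $ j + of_real (s - t) * (B ** H) $ i $ j)
        = mat 1 + (s - t) *\<^sub>R (B ** H)"
      by (simp add: vec_eq_iff) (simp add: scaleR_conv_of_real)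
    moreover have WBH: "W ** (B ** H) = H"
      by (metis B W_def matrix_mul_assoc matrix_mul_lid)
    moreover have "P + s *\<^sub>R H = W ** (mat 1 + (s - t) *\<^sub>R (B ** H))"
      unfolding matrix_add_ldistrib matrix_scalar_ac[of W] scalar_matrix_assoc[symmetric] WBH
      by (simp add: W_def algebra_simps)
    ultimately show ?thesis
      by simp
  qed
  have det_line: "det (P + s *\<^sub>R H) = det W * D (of_real (s - t))" for s
    by (simp only: line[of s] det_mul D_def)
  have "(D has_field_derivative trace (B ** H)) (at (of_real (t - t)))"
    unfolding D_def using det_one_plus_derivative[of "B ** H"] by simp
  moreover have "((\<lambda>s. of_real (s - t) :: complex) has_vector_derivative 1) (at t)"
    by (auto intro!: derivative_eq_intros)
  ultimately have "((\<lambda>s. D (of_real (s - t))) has_vector_derivative 1 * trace (B ** H)) (at t)"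
    using field_vector_diff_chain_at[of "\<lambda>s. of_real (s - t)" 1 t D] by (simp add: o_def)
  then have "((\<lambda>s. det W * D (of_real (s - t))) has_vector_derivative det W * trace (B ** H)) (at t)"
    by (auto intro!: derivative_eq_intros)
  then have "((\<lambda>s. det (P + s *\<^sub>R H)) has_vector_derivative det W * trace (B ** H)) (at t)"
    by (simp only: det_line)
  then have "((\<lambda>s. Re (det (P + s *\<^sub>R H))) has_real_derivative Re (det W * trace (B ** H))) (at t)"
    by (rule has_field_derivative_Re)
  \<comment> \<open>Since \<open>det W\<close> is real, the real part of the product splits, and
    \<open>det W\<close> then cancels against the derivative of \<open>ln\<close>.\<close>
  moreover have pos: "0 < Re (det W)" and "Im (det W) = 0"
    using assms(2) Re_det_pos_def Im_det_pos_def unfolding W_def by blast+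
  ultimately have "((\<lambda>s. Re (det (P + s *\<^sub>R H))) has_real_derivative
      Re (det W) * Re (trace (B ** H))) (at t)"
    by simp
  then have "((\<lambda>s. ln (Re (det (P + s *\<^sub>R H)))) has_real_derivative
      inverse (Re (det W)) * (Re (det W) * Re (trace (B ** H)))) (at t)"
    by (rule DERIV_chain2[rotated]) (use pos DERIV_ln in \<open>simp add: W_def\<close>)
  then show ?thesis
    using pos by (simp add: trace_mul_sym[of H B] flip: mult.assoc)
qed

section \<open>The two-point trace inequality\<close>

lemma matrix_add_rdistrib: "(A + B) ** C = A ** C + (B ** C :: complex^'n^'n)"
  by (simp add: matrix_matrix_mult_def vec_eq_iff algebra_simps sum.distrib)

lemma matrix_diff_ldistrib: "A ** (B - C) = A ** B - (A ** C :: complex^'n^'n)"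
  by (simp add: matrix_matrix_mult_def vec_eq_iff algebra_simps sum_subtractf)

lemma matrix_diff_rdistrib: "(A - B) ** C = A ** C - (B ** C :: complex^'n^'n)"
  by (simp add: matrix_matrix_mult_def vec_eq_iff algebra_simps sum_subtractf)

text \<open>Subtracting and adding the equations for \<open>a\<close> and \<open>b\<close> gives
  \<open>M ** (a - b) = K ** (a + b)\<close> and
  \<open>M ** (a + b) = mat 1 + mat 1 + K ** (a - b)\<close>. The third identity exhibits the excess
  of \<open>a + b\<close> over \<open>m + m\<close>, which is the midpoint convexity of the inverse
  once \<open>K\<close> is Hermitian and the inverses are semidefinite.\<close>

lemma two_sided_inverse_identities:
  fixes M K a b m :: "complex^'n^'n"
  assumes "M ** m = mat 1" "m ** M = mat 1"
    and "(M - K) ** a = mat 1" "a ** (M - K) = mat 1"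
    and "(M + K) ** b = mat 1" "b ** (M + K) = mat 1"
  shows "a - b = m ** K ** (a + b)" and "a - b = (a + b) ** K ** m"
    and "a + b = m + m + m ** K ** (a + b) ** K ** m"
proof -
  note dist = matrix_add_ldistrib matrix_add_rdistrib matrix_diff_ldistrib matrix_diff_rdistrib
  have left: "m ** (M ** x) = x" and right: "(x ** M) ** m = x" for x :: "complex^'n^'n"
    by (metis assms(1,2) matrix_mul_assoc matrix_mul_lid matrix_mul_rid)+
  have "M ** (a - b) = K ** (a + b)"
    using assms(3,5) by (simp add: dist algebra_simps)
  then show 1: "a - b = m ** K ** (a + b)"
    by (metis left matrix_mul_assoc)
  have "(a - b) ** M = (a + b) ** K"
    using assms(4,6) by (simp add: dist algebra_simps)
  then show 2: "a - b = (a + b) ** K ** m"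
    by (metis right)
  have "M ** (a + b) = mat 1 + mat 1 + K ** (a - b)"
    using assms(3,5) by (simp add: dist algebra_simps)
  then have "a + b = m ** (mat 1 + mat 1 + K ** (a - b))"
    by (metis left)
  then have "a + b = m + m + m ** K ** (a - b)"
    by (simp only: matrix_add_ldistrib matrix_mul_rid matrix_mul_assoc)
  \<comment> \<open>Inserting the right-handed form of \<open>a - b\<close> makes the excess a
    symmetric product.\<close>
  then show "a + b = m + m + m ** K ** (a + b) ** K ** m"
    by (subst (asm) 2) (simp add: matrix_mul_assoc)
qed

text \<open>
  For \<open>M = M' = 1\<close> and commuting scalars \<open>k\<close>, \<open>k'\<close> in place of left and right multiplication by \<open>K\<close>,
  the claim is the convexity of \<open>1 / (x * y)\<close>, in the form
  \<open>(1 - k\<^sup>2) * (1 - k'\<^sup>2) * (1 / ((1 - k) * (1 - k')) + 1 / ((1 + k) * (1 + k')) - 2)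
    = (k + k')\<^sup>2 + k\<^sup>2 * (1 - k'\<^sup>2) + k'\<^sup>2 * (1 - k\<^sup>2)\<close>.
  The matrix \<open>Z\<close> below plays the role of \<open>k + k'\<close>.
\<close>
lemma trace_inverse_two_point:
  fixes M M' K H a a' b b' m m' :: "complex^'n^'n"
  assumes M: "M ** m = mat 1" "m ** M = mat 1"
      "(M - K) ** a = mat 1" "a ** (M - K) = mat 1"
      "(M + K) ** b = mat 1" "b ** (M + K) = mat 1"
    and M': "M' ** m' = mat 1" "m' ** M' = mat 1"
      "(M' - K) ** a' = mat 1" "a' ** (M' - K) = mat 1"
      "(M' + K) ** b' = mat 1" "b' ** (M' + K) = mat 1"
    and psd: "pos_semidef a" "pos_semidef b" "pos_semidef m"
      "pos_semidef a'" "pos_semidef b'" "pos_semidef m'"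
    and "hermitian H" "hermitian K"
  shows "2 * Re (trace (H ** m ** H ** m'))
    \<le> Re (trace (H ** a ** H ** a')) + Re (trace (H ** b ** H ** b'))"
proof -
  define T where "T x y = Re (trace (H ** x ** H ** y))" for x y
  \<comment> \<open>Sum and difference of the two inverses; \<open>e\<close> below is the excess
    \<open>c - (m + m)\<close>.\<close>
  define c c' where "c = a + b" and "c' = a' + b'"
  define d d' where "d = a - b" and "d' = a' - b'"
  define e e' where "e = m ** K ** c ** K ** m" and "e' = m' ** K ** c' ** K ** m'"
  have adj: "adj H = H" "adj K = K" "adj m = m" "adj m' = m'"
    using assms by (simp_all add: hermitian_iff_adj pos_semidef_def)
  have c: "pos_semidef c" "pos_semidef c'"
    unfolding c_def c'_def using psd by (simp_all add: pos_semidef_add)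
  have e: "pos_semidef e" "pos_semidef e'"
    using pos_semidef_congruence[OF c(1), of "m ** K"] pos_semidef_congruence[OF c(2), of "m' ** K"]
    by (simp_all add: e_def e'_def adj_mult adj matrix_mul_assoc)
  have add: "T (x + y) z = T x z + T y z" "T z (x + y) = T z x + T z y"
    and diff: "T (x - y) z = T x z - T y z" "T z (x - y) = T z x - T z y" for x y z
    by (simp_all add: T_def matrix_add_ldistrib matrix_add_rdistrib matrix_diff_ldistrib
        matrix_diff_rdistrib trace_add trace_sub)
  have T_nonneg: "0 \<le> T x y" if "pos_semidef x" "pos_semidef y" for x y
    using trace_pos_semidef_mult[OF pos_semidef_congruence[OF that(1), of H] that(2)]
    by (simp add: T_def adj)
  have d_left: "d = m ** K ** c" "d' = m' ** K ** c'"
    and d_right: "d = c ** K ** m" "d' = c' ** K ** m'"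
    and c_split: "c = m + m + e" "c' = m' + m' + e'"
    unfolding c_def c'_def d_def d'_def e_def e'_def
    using two_sided_inverse_identities[OF M] two_sided_inverse_identities[OF M'] by blast+
  define Z where "Z = K ** m ** H + H ** m' ** K"
  have adj_Z: "adj Z = H ** m ** K + K ** m' ** H"
    by (simp add: Z_def adj_add adj_mult adj matrix_mul_assoc)
  \<comment> \<open>By cyclicity these traces become the four terms of
    \<open>Z ** c' ** adj Z ** c\<close>. \<open>T d d'\<close> supplies both cross terms, through
    the right-handed and the left-handed forms of \<open>d\<close> and \<open>d'\<close>.\<close>
  have "T e c' = Re (trace (K ** m ** H ** c' ** H ** m ** K ** c))"
    using trace_mul_sym[of "H ** m ** K ** c" "K ** m ** H ** c'"]
    by (simp add: T_def e_def matrix_mul_assoc)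
  moreover have "T d d' = Re (trace (K ** m ** H ** c' ** K ** m' ** H ** c))"
    using trace_mul_sym[of "H ** c' ** K ** m' ** H ** c" "K ** m"]
      trace_mul_sym[of "H ** d" "H ** d'"]
    by (simp add: T_def d_right matrix_mul_assoc)
  moreover have "T d d' = Re (trace (H ** m' ** K ** c' ** H ** m ** K ** c))"
    using trace_mul_sym[of "H ** d" "H ** d'"]
    by (simp add: T_def d_left matrix_mul_assoc)
  moreover have "T c e' = Re (trace (H ** m' ** K ** c' ** K ** m' ** H ** c))"
    using trace_mul_sym[of "H ** c" "H ** e'"]
    by (simp add: T_def e'_def matrix_mul_assoc)
  ultimately have "T e c' + T c e' + 2 * T d d' = Re (trace (Z ** c' ** adj Z ** c))"
    by (simp add: adj_Z) (simp add: Z_def matrix_add_ldistrib matrix_add_rdistrib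
        matrix_mul_assoc trace_add)
  also have "\<dots> \<ge> 0"
    by (rule trace_pos_semidef_mult[OF pos_semidef_congruence]) (fact c)+
  finally have "0 \<le> T e c' + T c e' + 2 * T d d'" .
  moreover have "0 \<le> T e m'" "0 \<le> T m e'"
    using e psd by (auto intro: T_nonneg)
  moreover have "T c c' + T d d' = 2 * (T a a' + T b b')"
    by (simp add: c_def c'_def d_def d'_def add diff)
  moreover have "T c c' = 4 * T m m' + 2 * T m e' + 2 * T e m' + T e e'"
    "T e c' = 2 * T e m' + T e e'" "T c e' = 2 * T m e' + T e e'"
    unfolding c_split add by simp_all
  \<comment> \<open>\<open>2 * (T a a' + T b b' - 2 * T m m')\<close> is half of the nonnegative sum
    \<open>T e c' + T c e' + 2 * T d d'\<close> plus \<open>T e m' + T m e'\<close>.\<close>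
  ultimately have "2 * T m m' \<le> T a a' + T b b'"
    by simp
  then show ?thesis
    by (simp only: T_def)
qed

section \<open>The divergence along a line\<close>

text \<open>The divergence with the logarithm of the product split, so that each term is
  \<open>ln det\<close> along a line.\<close>

definition log_det_gap :: "complex^'n^'n \<Rightarrow> complex^'n^'n \<Rightarrow> real" where
  "log_det_gap P Q = ln (Re (det ((1/2) *\<^sub>R (P + Q))))
     - 1/2 * ln (Re (det P)) - 1/2 * ln (Re (det Q))"

definition gap_slope :: "complex^'n^'n \<Rightarrow> complex^'n^'n \<Rightarrow> complex^'n^'n \<Rightarrow> real" where
  "gap_slope H P Q = Re (trace (H ** matrix_inv ((1/2) *\<^sub>R (P + Q))))
     - 1/2 * Re (trace (H ** matrix_inv P)) - 1/2 * Re (trace (H ** matrix_inv Q))"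

lemma S_div_sq_eq_log_det_gap:
  assumes "pos_def P" "pos_def Q"
  shows "S_div_sq P Q = log_det_gap P Q"
proof -
  have "Re (det (P ** Q)) = Re (det P) * Re (det Q)"
    using assms by (simp add: det_mul Im_det_pos_def)
  then show ?thesis
    using Re_det_pos_def[OF assms(1)] Re_det_pos_def[OF assms(2)]
    by (simp add: S_div_sq_def log_det_gap_def ln_mult field_simps)
qed

lemma pos_def_midpoint: "pos_def P \<Longrightarrow> pos_def Q \<Longrightarrow> pos_def ((1/2) *\<^sub>R (P + Q))"
  by (intro pos_def_scaleR pos_def_add pos_def_imp_pos_semidef) auto

text \<open>This brings a pair into the form \<open>M - K\<close>, \<open>M + K\<close> of the
  inverse identities.\<close>

lemma midpoint_split:
  fixes P Q :: "'a::real_vector"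
  shows "P = (1/2) *\<^sub>R (P + Q) - (1/2) *\<^sub>R (Q - P)" and "Q = (1/2) *\<^sub>R (P + Q) + (1/2) *\<^sub>R (Q - P)"
  by (simp_all add: algebra_simps flip: scaleR_add_left)

lemma log_det_gap_derivative:
  assumes "pos_def (P + t *\<^sub>R H)" "pos_def (Q + t *\<^sub>R H)"
  shows "((\<lambda>s. log_det_gap (P + s *\<^sub>R H) (Q + s *\<^sub>R H)) has_real_derivative
    gap_slope H (P + t *\<^sub>R H) (Q + t *\<^sub>R H)) (at t)"
proof -
  have mid: "(1/2) *\<^sub>R ((P + s *\<^sub>R H) + (Q + s *\<^sub>R H)) = (1/2) *\<^sub>R (P + Q) + s *\<^sub>R H" for s
    by (simp add: algebra_simps flip: scaleR_add_left)
  have "pos_def ((1/2) *\<^sub>R (P + Q) + t *\<^sub>R H)"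
    using pos_def_midpoint[OF assms] by (simp only: mid)
  then show ?thesis
    unfolding log_det_gap_def gap_slope_def mid using assms
    by (intro DERIV_diff DERIV_cmult ln_det_line_derivative pos_def_matrix_inv)
qed

text \<open>The slope is \<open>-1/2\<close> times the trace of \<open>H ** W\<close>, where the
  semidefinite \<open>W\<close> is the excess in the midpoint convexity of the inverse.\<close>

lemma gap_slope_nonpos:
  assumes "pos_def P" "pos_def Q" "pos_semidef H"
  shows "gap_slope H P Q \<le> 0"
proof -
  define M K where "M = (1/2) *\<^sub>R (P + Q)" and "K = (1/2) *\<^sub>R (Q - P)"
  have PQ: "P = M - K" "Q = M + K"
    unfolding M_def K_def by (rule midpoint_split)+
  have M: "pos_def M"
    unfolding M_def using assms(1,2) by (rule pos_def_midpoint)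
  note inv = pos_def_matrix_inv(1,2)
  define a b m where "a = matrix_inv P" and "b = matrix_inv Q" and "m = matrix_inv M"
  have psd: "pos_semidef (a + b)" "pos_semidef m"
    unfolding a_def b_def m_def using assms M by (auto intro: pos_semidef_add pos_def_matrix_inv)
  have "adj K = K"
    using assms by (simp add: K_def pos_def_def hermitian_iff_adj adj_scaleR adj_diff)
  moreover have "adj m = m"
    using psd by (simp add: pos_semidef_def hermitian_iff_adj)
  moreover define W where "W = m ** K ** (a + b) ** K ** m"
  ultimately have "pos_semidef W"
    using pos_semidef_congruence[OF psd(1), of "m ** K"] by (simp add: adj_mult matrix_mul_assoc)
  then have "0 \<le> Re (trace (H ** W))"
    by (rule trace_pos_semidef_mult[OF assms(3)])
  moreover have "a + b = m + m + W"
    using two_sided_inverse_identities(3)[OF inv[OF M] inv[OF assms(1), unfolded PQ]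
        inv[OF assms(2), unfolded PQ]]
    by (simp only: a_def b_def m_def W_def PQ)
  then have "trace (H ** a) + trace (H ** b) = trace (H ** m) + trace (H ** m) + trace (H ** W)"
    by (metis matrix_add_ldistrib trace_add)
  then have "Re (trace (H ** a)) + Re (trace (H ** b)) = 2 * Re (trace (H ** m)) + Re (trace (H ** W))"
    by (simp add: complex_eq_iff)
  ultimately show ?thesis
    unfolding gap_slope_def a_def[symmetric] b_def[symmetric] M_def[symmetric] m_def[symmetric]
    by linarith
qed

text \<open>The resolvent identity \<open>a - b = r *\<^sub>R (a ** H ** b)\<close>, obtained by
  evaluating \<open>a ** (P + r *\<^sub>R H) ** b\<close> in two ways.\<close>

lemma trace_inverse_difference:
  fixes P H :: "complex^'n^'n"
  assumes "pos_def P" "pos_def (P + r *\<^sub>R H)"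
  shows "Re (trace (H ** matrix_inv P)) - Re (trace (H ** matrix_inv (P + r *\<^sub>R H)))
    = r * Re (trace (H ** matrix_inv P ** H ** matrix_inv (P + r *\<^sub>R H)))"
proof -
  define a b where "a = matrix_inv P" and "b = matrix_inv (P + r *\<^sub>R H)"
  have a: "a ** P = mat 1" and b: "(P + r *\<^sub>R H) ** b = mat 1"
    unfolding a_def b_def using assms by (simp_all add: pos_def_matrix_inv)
  have "a ** (P + r *\<^sub>R H) ** b = a"
    by (simp add: b flip: matrix_mul_assoc)
  moreover have "a ** (P + r *\<^sub>R H) ** b = b + r *\<^sub>R (a ** H ** b)"
    unfolding matrix_add_ldistrib matrix_add_rdistrib matrix_scalar_ac
      scalar_matrix_assoc[symmetric] a
    by simp
  ultimately have "H ** a = H ** (b + r *\<^sub>R (a ** H ** b))"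
    by simp
  also have "\<dots> = H ** b + r *\<^sub>R (H ** a ** H ** b)"
    unfolding matrix_add_ldistrib matrix_scalar_ac scalar_matrix_assoc[symmetric] matrix_mul_assoc ..
  finally have "trace (H ** a) = trace (H ** b + r *\<^sub>R (H ** a ** H ** b))"
    by (rule arg_cong)
  also have "\<dots> = trace (H ** b) + r *\<^sub>R trace (H ** a ** H ** b)"
    by (simp add: trace_add) (simp add: trace_def scaleR_sum_right)
  finally show ?thesis
    by (simp add: a_def b_def)
qed

text \<open>The resolvent identity at \<open>P\<close>, \<open>Q\<close> and their midpoint turns
  the increment into \<open>r / 2\<close> times the defect of the two-point inequality. Both ends
  share the same \<open>K\<close>, since \<open>Q - P\<close> is constant along the line.
  \<open>H\<close> is only Hermitian because convexity involves directions of indefinite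
  sign.\<close>

lemma gap_slope_mono:
  assumes PQ: "pos_def P" "pos_def Q" "pos_def (P + r *\<^sub>R H)" "pos_def (Q + r *\<^sub>R H)"
    and "hermitian H" "0 \<le> r"
  shows "gap_slope H P Q \<le> gap_slope H (P + r *\<^sub>R H) (Q + r *\<^sub>R H)"
proof -
  define M K where "M = (1/2) *\<^sub>R (P + Q)" and "K = (1/2) *\<^sub>R (Q - P)"
  have P: "P = M - K" and Q: "Q = M + K"
    unfolding M_def K_def by (rule midpoint_split)+
  have mid: "(1/2) *\<^sub>R ((P + r *\<^sub>R H) + (Q + r *\<^sub>R H)) = M + r *\<^sub>R H"
    by (simp add: M_def algebra_simps flip: scaleR_add_left)
  have M: "pos_def M" "pos_def (M + r *\<^sub>R H)"
    using pos_def_midpoint[OF PQ(1,2)] pos_def_midpoint[OF PQ(3,4)] by (simp_all only: mid M_def)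
  have P': "P + r *\<^sub>R H = (M + r *\<^sub>R H) - K" and Q': "Q + r *\<^sub>R H = (M + r *\<^sub>R H) + K"
    by (simp_all add: P Q)
  have "hermitian K"
    using PQ by (simp add: K_def pos_def_def hermitian_iff_adj adj_scaleR adj_diff)
  note inv = pos_def_matrix_inv
  have "2 * Re (trace (H ** matrix_inv M ** H ** matrix_inv (M + r *\<^sub>R H)))
      \<le> Re (trace (H ** matrix_inv P ** H ** matrix_inv (P + r *\<^sub>R H)))
       + Re (trace (H ** matrix_inv Q ** H ** matrix_inv (Q + r *\<^sub>R H)))"
    by (rule trace_inverse_two_point[of M _ K _ _ "M + r *\<^sub>R H"])
      (use inv[OF M(1)] inv[OF M(2)] inv[OF PQ(1)] inv[OF PQ(2)] inv[OF PQ(3)] inv[OF PQ(4)]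
        \<open>hermitian H\<close> \<open>hermitian K\<close> in \<open>simp_all only: P[symmetric] Q[symmetric] P'[symmetric] Q'[symmetric]\<close>)
  then have "r * (2 * Re (trace (H ** matrix_inv M ** H ** matrix_inv (M + r *\<^sub>R H))))
      \<le> r * (Re (trace (H ** matrix_inv P ** H ** matrix_inv (P + r *\<^sub>R H)))
       + Re (trace (H ** matrix_inv Q ** H ** matrix_inv (Q + r *\<^sub>R H))))"
    using \<open>0 \<le> r\<close> by (rule mult_left_mono)
  then show ?thesis
    unfolding gap_slope_def mid M_def[symmetric]
    using trace_inverse_difference[OF M] trace_inverse_difference[OF PQ(1,3)]
      trace_inverse_difference[OF PQ(2,4)]
    by (simp add: algebra_simps)
qed

section \<open>From segments to the semidefinite cone\<close>

lemma pos_semidef_segment: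
  assumes "pos_semidef A" "pos_semidef B" "0 \<le> t" "t \<le> 1"
  shows "pos_semidef (A + t *\<^sub>R (B - A))"
proof -
  have "A + t *\<^sub>R (B - A) = (1 - t) *\<^sub>R A + t *\<^sub>R B"
    by (simp add: algebra_simps)
  then show ?thesis
    using assms by (simp add: pos_semidef_add pos_semidef_scaleR)
qed

theorem theorem4p10:
  fixes X Y :: "complex^'n^'n"
  assumes "pos_def X" and "pos_def Y"
  shows "monotone_on {A. pos_semidef A} loewner_le (\<ge>) (\<lambda>A. S_div_sq (A + X) (A + Y)) \<and>
         convex_on {A. pos_semidef A} (\<lambda>A. S_div_sq (A + X) (A + Y))"
proof
  let ?g = "\<lambda>A. S_div_sq (A + X) (A + Y)"
  define h where "h A B t = log_det_gap (A + X + t *\<^sub>R (B - A)) (A + Y + t *\<^sub>R (B - A))" for A B t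
  define h' where "h' A B t = gap_slope (B - A) (A + X + t *\<^sub>R (B - A)) (A + Y + t *\<^sub>R (B - A))"
    for A B t
  \<comment> \<open>The definite \<open>Z\<close> keeps the matrix definite even at the endpoints,
    where \<open>A\<close> or \<open>B\<close> may be singular; hence two-sided derivatives exist on
    the closed segment.\<close>
  have pos: "pos_def (A + Z + t *\<^sub>R (B - A))"
    if "pos_semidef A" "pos_semidef B" "0 \<le> t" "t \<le> 1" "pos_def Z" for A B Z :: "complex^'n^'n" and t
    using pos_def_add[OF pos_semidef_segment[OF that(1-4)] that(5)] by (simp add: algebra_simps)
  have g_eq: "?g (A + t *\<^sub>R (B - A)) = h A B t"
    if "pos_semidef A" "pos_semidef B" "0 \<le> t" "t \<le> 1" for A B t
    using S_div_sq_eq_log_det_gap[OF pos[OF that assms(1)] pos[OF that assms(2)]]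
    by (simp add: h_def algebra_simps)
  have deriv: "(h A B has_real_derivative h' A B t) (at t)"
    if "pos_semidef A" "pos_semidef B" "0 \<le> t" "t \<le> 1" for A B t
    unfolding h_def[abs_def] h'_def
    by (intro log_det_gap_derivative pos[OF that] assms)
  show "monotone_on {A. pos_semidef A} loewner_le (\<ge>) ?g"
  proof (rule monotone_onI)
    fix A B :: "complex^'n^'n"
    assume "A \<in> {A. pos_semidef A}" "B \<in> {A. pos_semidef A}" and "loewner_le A B"
    then have AB: "pos_semidef A" "pos_semidef B" and BA: "pos_semidef (B - A)"
      by (simp_all add: loewner_le_def)
    have "h A B 0 \<ge> h A B 1"
    proof (rule DERIV_nonpos_imp_nonincreasing[where f = "h A B"])
      fix t :: real assume t: "0 \<le> t" "t \<le> 1"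
      then show "\<exists>y. (h A B has_real_derivative y) (at t) \<and> y \<le> 0"
        using deriv[OF AB t] gap_slope_nonpos[OF pos[OF AB t assms(1)] pos[OF AB t assms(2)] BA]
        unfolding h'_def by blast
    qed simp
    then show "?g A \<ge> ?g B"
      using g_eq[OF AB, of 0] g_eq[OF AB, of 1] by simp
  qed
  show "convex_on {A. pos_semidef A} ?g"
  proof (rule convex_onI)
    show "convex {A :: complex^'n^'n. pos_semidef A}"
      by (auto simp: convex_def intro: pos_semidef_add pos_semidef_scaleR)
    fix t :: real and A B :: "complex^'n^'n"
    assume t: "0 < t" "t < 1" and "A \<in> {A. pos_semidef A}" "B \<in> {A. pos_semidef A}"
    then have AB: "pos_semidef A" "pos_semidef B"
      by simp_all
    have herm: "hermitian (B - A)"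
      using AB by (simp add: pos_semidef_def hermitian_iff_adj adj_diff)
    \<comment> \<open>Convexity on the cone reduces to convexity on each segment, that is, to a
      nondecreasing slope.\<close>
    have "convex_on {0..1} (h A B)"
    proof (rule convex_on_realI)
      show "(h A B has_real_derivative h' A B s) (at s)" if "s \<in> {0..1}" for s
        using deriv[OF AB] that by simp
      show "h' A B s \<le> h' A B u" if "s \<in> {0..1}" "u \<in> {0..1}" "s \<le> u" for s u
      proof -
        \<comment> \<open>Restarting the line at \<open>s\<close> makes \<open>u - s\<close> the
          step \<open>r\<close> of \<open>gap_slope_mono\<close>.\<close>
        have shift: "W + s *\<^sub>R (B - A) + (u - s) *\<^sub>R (B - A) = W + u *\<^sub>R (B - A)" for W
          by (simp add: algebra_simps)
        then show ?thesis
          unfolding h'_def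
          using gap_slope_mono[of "A + X + s *\<^sub>R (B - A)" "A + Y + s *\<^sub>R (B - A)" "u - s" "B - A",
              unfolded shift] pos[OF AB] assms herm that by simp
      qed
    qed simp
    then have "h A B ((1 - t) *\<^sub>R 0 + t *\<^sub>R 1) \<le> (1 - t) * h A B 0 + t * h A B 1"
      by (rule convex_onD) (use t in auto)
    moreover have "(1 - t) *\<^sub>R A + t *\<^sub>R B = A + t *\<^sub>R (B - A)"
      by (simp add: algebra_simps)
    ultimately show "?g ((1 - t) *\<^sub>R A + t *\<^sub>R B) \<le> (1 - t) * ?g A + t * ?g B"
      using g_eq[OF AB, of 0] g_eq[OF AB, of 1] g_eq[OF AB, of t] t by simp
  qed
qed

end
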